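(* Let $(\Omega,\Sigma,\mu)$ be a measure space and let $f:\Omega\to\mathbb{R}$ be a real-valued measurable function. Let $n\ge 1$ and let $0<\lambda_1<\lambda_2<\cdots<\lambda_n<\infty$ be real numbers. Suppose $\phi:\mathbb{R}\to[0,\infty]$ is a nonnegative, nondecreasing, extended real-valued measurable function with $\phi(\lambda_1)>0$. Then $$\sum_{k=1}^{n}\left[\phi(\lambda_k)-\phi(\lambda_{k-1})\right]\mu(\{x\in\Omega : f(x)\ge\lambda_k\})\le\int_\Omega \phi\circ f\,d\mu,$$ where, by convention, $\phi(\lambda_0)=0$.
   Context: The symbol $\phi(\lambda_0)$ is merely notation for the number $0$, so the $k=1$ term of the sum is $\phi(\lambda_1)\,\mu(\{x\in\Omega: f(x)\ge\lambda_1\})$. The integral on the right is the Lebesgue integral of a nonnegative measurable function and takes values in $[0,\infty]$. The usual measure-theoretic conventions are used: $0\cdot\infty=0$, and a difference $\infty-\infty$ (which can occur only if $\phi(\lambda_{k-1})=\phi(\lambda_k)=\infty$) is read as $0$. *)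

theory Defs
  imports "HOL-Analysis.Analysis"
begin

(* In the library top - top = top on ennreal; here infinity - infinity is read as 0.
   Elsewhere this is the library subtraction, which truncates at 0 when a < b. *)
definition ennreal_diff :: "ennreal \<Rightarrow> ennreal \<Rightarrow> ennreal" where
  "ennreal_diff a b = (if a = top \<and> b = top then 0 else a - b)"

(* The value phi(lambda_k), where phi(lambda_0) is only notation for 0:
   lam 0 is never evaluated. *)
definition phi_at :: "(real \<Rightarrow> ennreal) \<Rightarrow> (nat \<Rightarrow> real) \<Rightarrow> nat \<Rightarrow> ennreal" where
  "phi_at \<phi> lam k = (if k = 0 then 0 else \<phi> (lam k))"

end

theory Submission
  imports Defs
begin

text \<open>
  The left-hand side is the integral of the step function
  \<open>s t = (\<Sum>k=1..n. [\<phi> \<lambda>\<^sub>k - \<phi> \<lambda>\<^sub>k\<^sub>-\<^sub>1] * indicator {\<lambda>\<^sub>k..} t)\<close> composed with \<open>f\<close>, so it suffices to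
  show \<open>s \<le> \<phi>\<close> pointwise. At a point \<open>t\<close> only the increments with \<open>\<lambda>\<^sub>k \<le> t\<close> contribute. If \<open>\<lambda>\<^sub>m\<close> is the
  largest threshold not exceeding \<open>t\<close>, they telescope to \<open>\<phi> \<lambda>\<^sub>m\<close>, which is at most \<open>\<phi> t\<close> because \<open>\<phi>\<close> is
  nondecreasing (and the empty sum is at most \<open>\<phi> t\<close> because \<open>\<phi>\<close> is nonnegative).
  The telescoping survives the value \<open>\<infinity>\<close>: when \<open>\<phi>\<close> first becomes infinite, the increment
  \<open>\<infinity> - \<phi> \<lambda>\<^sub>k\<^sub>-\<^sub>1\<close> is \<open>\<infinity>\<close>, and the later increments \<open>\<infinity> - \<infinity> = 0\<close> leave the sum unchanged.
\<close>

lemma ennreal_diff_add_cancel: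
  assumes "a \<le> b"
  shows "a + ennreal_diff b a = b"
  using assms by (auto simp: ennreal_diff_def diff_add_cancel_ennreal add.commute)

lemma sum_ennreal_diff_telescope:
  fixes a :: "nat \<Rightarrow> ennreal"
  assumes "a 0 = 0" and "\<And>k. k < m \<Longrightarrow> a k \<le> a (Suc k)"
  shows "(\<Sum>k=1..m. ennreal_diff (a k) (a (k - 1))) = a m"
  using assms by (induction m) (simp_all add: ennreal_diff_add_cancel)

text \<open>
  Induction on the number of steps avoids choosing the largest threshold not exceeding \<open>t\<close>: a new step that
  \<open>t\<close> does not reach contributes nothing, and one that \<open>t\<close> does reach lets every indicator
  be bounded by \<open>1\<close>, after which the whole sum telescopes.
\<close>
lemma step_function_le:
  fixes a :: "nat \<Rightarrow> ennreal" and lam :: "nat \<Rightarrow> real"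
  assumes "a 0 = 0" and "\<And>k. k < m \<Longrightarrow> a k \<le> a (Suc k)"
    and "\<And>k. k \<in> {1..m} \<Longrightarrow> lam k \<le> t \<Longrightarrow> a k \<le> c"
  shows "(\<Sum>k=1..m. ennreal_diff (a k) (a (k - 1)) * indicator {lam k..} t) \<le> c"
  using assms
proof (induction m)
  case 0
  show ?case by simp
next
  case (Suc m)
  show ?case
  proof (cases "lam (Suc m) \<le> t")
    case True
    have "(\<Sum>k=1..Suc m. ennreal_diff (a k) (a (k - 1)) * indicator {lam k..} t)
        \<le> (\<Sum>k=1..Suc m. ennreal_diff (a k) (a (k - 1)))"
      by (intro sum_mono) (simp split: split_indicator)
    also have "\<dots> = a (Suc m)"
      using Suc.prems(1,2) by (rule sum_ennreal_diff_telescope)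
    also have "\<dots> \<le> c"
      using Suc.prems(3) True by simp
    finally show ?thesis .
  next
    case False
    then show ?thesis using Suc by simp
  qed
qed

theorem theorem2p2:
  fixes M :: "'a measure" and f :: "'a \<Rightarrow> real" and n :: nat
    and lam :: "nat \<Rightarrow> real" and \<phi> :: "real \<Rightarrow> ennreal"
  assumes "f \<in> borel_measurable M"
    and "n \<ge> 1"
    and "0 < lam 1"
    and "strict_mono_on {1..n} lam"
    and "mono \<phi>"
    and "\<phi> \<in> borel_measurable borel"
    and "\<phi> (lam 1) > 0"
  shows "(\<Sum>k=1..n. ennreal_diff (phi_at \<phi> lam k) (phi_at \<phi> lam (k - 1))
            * emeasure M {x \<in> space M. f x \<ge> lam k})
         \<le> (\<integral>\<^sup>+ x. (\<phi> \<circ> f) x \<partial>M)"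
proof -
  note [measurable] = \<open>f \<in> borel_measurable M\<close>
  let ?d = "\<lambda>k. ennreal_diff (phi_at \<phi> lam k) (phi_at \<phi> lam (k - 1))"
  let ?A = "\<lambda>k. {x \<in> space M. f x \<ge> lam k}"
  have mono_phi_at: "phi_at \<phi> lam k \<le> phi_at \<phi> lam (Suc k)" if "k < n" for k
  proof (cases "k = 0")
    case False
    then have "lam k \<le> lam (Suc k)"
      using that by (intro less_imp_le strict_mono_onD[OF \<open>strict_mono_on {1..n} lam\<close>]) auto
    then show ?thesis
      using False \<open>mono \<phi>\<close> by (simp add: phi_at_def monoD)
  qed (simp add: phi_at_def)
  have pointwise: "(\<Sum>k=1..n. ?d k * indicator (?A k) x) \<le> (\<phi> \<circ> f) x" if "x \<in> space M" for x
  proof -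
    have "(\<Sum>k=1..n. ?d k * indicator (?A k) x) = (\<Sum>k=1..n. ?d k * indicator {lam k..} (f x))"
      using that by (intro sum.cong) (auto simp: indicator_def)
    also have "\<dots> \<le> \<phi> (f x)"
      using \<open>mono \<phi>\<close> by (intro step_function_le mono_phi_at) (auto simp: phi_at_def monoD)
    finally show ?thesis by simp
  qed
  have "(\<Sum>k=1..n. ?d k * emeasure M (?A k)) = (\<integral>\<^sup>+ x. (\<Sum>k=1..n. ?d k * indicator (?A k) x) \<partial>M)"
    by (subst nn_integral_sum) (auto simp: nn_integral_cmult_indicator)
  also have "\<dots> \<le> (\<integral>\<^sup>+ x. (\<phi> \<circ> f) x \<partial>M)"
    by (intro nn_integral_mono pointwise)
  finally show ?thesis .
qed

end
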